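(* Let $(L,\alpha)$ be a Hom-Lie algebra with $\alpha$ surjective and let $(V,\rho,\beta)$ be an $(L,\alpha)$-module with $\beta$ invertible. If $Z_V(L')=\{0\}$, then $\mathrm{Cent}(L,V)=\mathrm{Com}(L,V)$.
   Context: All vector spaces are over a fixed field $\mathbb F$ with $\mathrm{char}(\mathbb F)\neq 2$. A (multiplicative) Hom-Lie algebra $(L,\alpha)$ is a vector space $L$ with a bilinear bracket $[-,-]:L\times L\to L$ and a linear map $\alpha:L\to L$ such that $[x,y]=-[y,x]$, $[\alpha(x),[y,z]]+[\alpha(y),[z,x]]+[\alpha(z),[x,y]]=0$ and $\alpha([x,y])=[\alpha(x),\alpha(y)]$ for all $x,y,z\in L$. Put $L'=[L,L]$ (the span of all brackets). An $(L,\alpha)$-module $(V,\rho,\beta)$ is a vector space $V$ with a linear map $\rho:L\to\mathrm{End}(V)$ and $\beta\in\mathrm{End}(V)$ such that for all $x,y\in L$: $\beta\rho(x)=\rho(\alpha(x))\beta$ and $\rho([x,y])\beta=\rho(\alpha(x))\rho(y)-\rho(\alpha(y))\rho(x)$. Write $xv=\rho(x)(v)$. For $S\subseteq L$ put $Z_V(S)=\{v\in V: sv=0\ \text{for all } s\in S\}$. $\mathrm{Cent}(L,V)$ is the set of linear maps $\gamma:L\to V$ such that $\gamma([x,y])=\alpha(x)\gamma(y)$ for all $x,y\in L$ and $\beta\circ\gamma=\gamma\circ\alpha$. $\mathrm{Com}(L,V)$ is the set of commuting linear maps, i.e. linear maps $f:L\to V$ such that $\alpha(x)f(x)=0$ for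 all $x\in L$ and $\beta\circ f=f\circ\alpha$. *)

theory Defs
  imports Complex_Main
begin

text \<open>
  Vector spaces are whole types with an explicit scalar multiplication, in the style of
  \<^theory>\<open>HOL.Vector_Spaces\<close>. Both spaces share the scalar field, a type \<open>'f\<close> of class
  \<^class>\<open>field\<close>; no finiteness of dimension is assumed.
\<close>

locale hom_lie_algebra = vector_space scale
  for scale :: "'f::field \<Rightarrow> 'l::ab_group_add \<Rightarrow> 'l" +
  fixes bracket :: "'l \<Rightarrow> 'l \<Rightarrow> 'l"
    and \<alpha> :: "'l \<Rightarrow> 'l"
  assumes linear_bracket_right: "Vector_Spaces.linear scale scale (\<lambda>y. bracket x y)"
    and linear_bracket_left: "Vector_Spaces.linear scale scale (\<lambda>x. bracket x y)"
    and linear_twist: "Vector_Spaces.linear scale scale \<alpha>"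
    and bracket_skew: "bracket x y = - bracket y x"
    and hom_jacobi:
      "bracket (\<alpha> x) (bracket y z) + bracket (\<alpha> y) (bracket z x) + bracket (\<alpha> z) (bracket x y) = 0"
    and multiplicative: "\<alpha> (bracket x y) = bracket (\<alpha> x) (\<alpha> y)"

locale hom_lie_module =
  L: hom_lie_algebra scaleL bracket \<alpha> + V: vector_space scaleV
  for scaleL :: "'f::field \<Rightarrow> 'l::ab_group_add \<Rightarrow> 'l"
    and bracket :: "'l \<Rightarrow> 'l \<Rightarrow> 'l"
    and \<alpha> :: "'l \<Rightarrow> 'l"
    and scaleV :: "'f \<Rightarrow> 'v::ab_group_add \<Rightarrow> 'v" +
  fixes \<rho> :: "'l \<Rightarrow> 'v \<Rightarrow> 'v"
    and \<beta> :: "'v \<Rightarrow> 'v"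
  assumes linear_action: "Vector_Spaces.linear scaleV scaleV (\<rho> x)"
    and linear_representation: "Vector_Spaces.linear scaleL scaleV (\<lambda>x. \<rho> x v)"
    and linear_module_twist: "Vector_Spaces.linear scaleV scaleV \<beta>"
    and twist_action: "\<beta> \<circ> \<rho> x = \<rho> (\<alpha> x) \<circ> \<beta>"
    and bracket_action: "\<rho> (bracket x y) (\<beta> v) = \<rho> (\<alpha> x) (\<rho> y v) - \<rho> (\<alpha> y) (\<rho> x v)"

definition derived_algebra ::
  "('f::field \<Rightarrow> 'l::ab_group_add \<Rightarrow> 'l) \<Rightarrow> ('l \<Rightarrow> 'l \<Rightarrow> 'l) \<Rightarrow> 'l set" where
  "derived_algebra scaleL bracket = module.span scaleL {bracket x y | x y. True}"

text \<open>\<open>annihilated \<rho> S\<close> is written \<open>Z\<^sub>V(S)\<close> in the literature.\<close>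

definition annihilated :: "('l \<Rightarrow> 'v::zero \<Rightarrow> 'v) \<Rightarrow> 'l set \<Rightarrow> 'v set" where
  "annihilated \<rho> S = {v. \<forall>s\<in>S. \<rho> s v = 0}"

definition Cent ::
  "('f::field \<Rightarrow> 'l::ab_group_add \<Rightarrow> 'l) \<Rightarrow> ('l \<Rightarrow> 'l \<Rightarrow> 'l) \<Rightarrow> ('l \<Rightarrow> 'l) \<Rightarrow>
   ('f \<Rightarrow> 'v::ab_group_add \<Rightarrow> 'v) \<Rightarrow> ('l \<Rightarrow> 'v \<Rightarrow> 'v) \<Rightarrow> ('v \<Rightarrow> 'v) \<Rightarrow> ('l \<Rightarrow> 'v) set" where
  "Cent scaleL bracket \<alpha> scaleV \<rho> \<beta> =
    {\<gamma>. Vector_Spaces.linear scaleL scaleV \<gamma> \<and>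
        (\<forall>x y. \<gamma> (bracket x y) = \<rho> (\<alpha> x) (\<gamma> y)) \<and> \<beta> \<circ> \<gamma> = \<gamma> \<circ> \<alpha>}"

definition Com ::
  "('f::field \<Rightarrow> 'l::ab_group_add \<Rightarrow> 'l) \<Rightarrow> ('l \<Rightarrow> 'l) \<Rightarrow>
   ('f \<Rightarrow> 'v::ab_group_add \<Rightarrow> 'v) \<Rightarrow> ('l \<Rightarrow> 'v \<Rightarrow> 'v) \<Rightarrow> ('v \<Rightarrow> 'v) \<Rightarrow> ('l \<Rightarrow> 'v) set" where
  "Com scaleL \<alpha> scaleV \<rho> \<beta> =
    {f. Vector_Spaces.linear scaleL scaleV f \<and>
        (\<forall>x. \<rho> (\<alpha> x) (f x) = 0) \<and> \<beta> \<circ> f = f \<circ> \<alpha>}"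

end

theory Submission
  imports Defs
begin

text \<open>
  One inclusion is immediate: skew-symmetry and characteristic different from \<open>2\<close> give
  \<open>[x, x] = 0\<close>, so a centroid map satisfies \<open>\<alpha>(x) \<gamma>(x) = \<gamma>([x, x]) = 0\<close>.

  For the other one, the twists are removed first. Since \<open>\<beta>\<close> is invertible, one may let \<open>x\<close> act on
  \<open>V\<close> by \<open>x \<cdot> v = \<beta>\<inverse>(x v)\<close>, and replace \<open>[x, y]\<close> by any preimage of it under \<open>\<alpha>\<close>. The choice of
  the preimage is irrelevant: \<open>\<beta> (x v) = \<alpha>(x) \<beta>(v)\<close> shows that the kernel of \<open>\<alpha>\<close> acts by zero,
  and \<open>\<beta> \<circ> f = f \<circ> \<alpha>\<close> that it is killed by every commuting map \<open>f\<close>. The new bracket acts as the commutator of the new action. The map \<open>f\<close> becomes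
  \<open>g = \<beta>\<inverse> \<circ> f\<close> with \<open>x \<cdot> g(y) = - (y \<cdot> g(x))\<close>, and the claim becomes \<open>g([x, y]) = x \<cdot> g(y)\<close>.

  In this untwisted form \<open>B(x, y) = x \<cdot> g(y)\<close> is a skew-symmetric biderivation. Evaluating
  \<open>B([x, u], [y, v])\<close> in two ways yields \<open>[x, y] \<cdot> B(u, v) = - [u, v] \<cdot> B(x, y)\<close>
  (\<open>bracket_biderivation_swap\<close>). This identity moves an arbitrary \<open>[u, v]\<close> across the
  cyclic sum of \<open>B(x, [y, z])\<close> and turns that sum into the Jacobi identity for commutators. So
  the cyclic sum is annihilated by all brackets and hence zero (\<open>cyclic_sum_eq_0\<close>). Expanding it
  shows that every element of \<open>L\<close> annihilates \<open>g([x, y]) - x \<cdot> g(y)\<close>, which therefore vanishes.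
\<close>

section \<open>Commuting maps for an action by commutators\<close>

text \<open>
  Every identity below takes place in \<open>V\<close>, where the bracket acts as a commutator, so the bracket
  itself may be an arbitrary operation. This lets an arbitrary preimage under the twist serve as the
  untwisted bracket, although such a choice need be neither bilinear nor skew-symmetric.
\<close>

locale commuting_map =
  fixes act :: "'l \<Rightarrow> 'v::ab_group_add \<Rightarrow> 'v" (infixr \<open>\<cdot>\<close> 75)
    and br :: "'l \<Rightarrow> 'l \<Rightarrow> 'l"
    and g :: "'l \<Rightarrow> 'v"
  assumes act_add: "x \<cdot> (v + w) = x \<cdot> v + x \<cdot> w"
    and br_act: "br x y \<cdot> v = x \<cdot> y \<cdot> v - y \<cdot> x \<cdot> v"
    and commuting: "x \<cdot> g y = - (y \<cdot> g x)"
    and faithful_br: "(\<And>x y. br x y \<cdot> v = 0) \<Longrightarrow> v = 0"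
    and no_two_torsion: "v + v = 0 \<Longrightarrow> v = 0"
begin

lemma act_zero [simp]: "x \<cdot> 0 = 0"
  using act_add[of x 0 0] by simp

lemma act_minus: "x \<cdot> (- v) = - (x \<cdot> v)"
  using act_add[of x v "- v"] by (simp add: eq_neg_iff_add_eq_0 add.commute)

lemma act_diff: "x \<cdot> (v - w) = x \<cdot> v - x \<cdot> w"
  using act_add[of x v "- w"] by (simp add: act_minus)

text \<open>
  Let \<open>Q(x, y; u, v) = [x, y] \<cdot> B(u, v) + [u, v] \<cdot> B(x, y)\<close>. It is skew in \<open>x, y\<close> and in \<open>u, v\<close>, and
  the two expansions of \<open>B([x, u], [y, v])\<close> show that it is unchanged when \<open>y\<close> and \<open>v\<close> are
  exchanged. A signed symmetry argument then forces \<open>2 Q = 0\<close>.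
\<close>

lemma bracket_biderivation_swap:
  "br x y \<cdot> u \<cdot> g v = - (br u v \<cdot> x \<cdot> g y)"
proof -
  define Q where "Q x y u v = br x y \<cdot> u \<cdot> g v + br u v \<cdot> x \<cdot> g y" for x y u v
  have derivation_right: "p \<cdot> g (br y v) = y \<cdot> p \<cdot> g v - v \<cdot> p \<cdot> g y" for p y v
  proof -
    have "p \<cdot> g (br y v) = - (y \<cdot> v \<cdot> g p - v \<cdot> y \<cdot> g p)"
      by (simp only: commuting[of p] br_act)
    also have "\<dots> = y \<cdot> p \<cdot> g v - v \<cdot> p \<cdot> g y"
      by (simp add: commuting[of v p] commuting[of y p] act_minus)
    finally show ?thesis .
  qed
  have exchange: "Q x y u v = Q x v u y" for x y u v
  proof -
    have "x \<cdot> u \<cdot> g (br y v) - u \<cdot> x \<cdot> g (br y v)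
        = y \<cdot> br x u \<cdot> g v - v \<cdot> br x u \<cdot> g y"
      using derivation_right[of "br x u" y v] by (simp add: br_act)
    then show ?thesis
      unfolding Q_def derivation_right br_act act_diff by (simp add: algebra_simps)
  qed
  have skew: "Q x y u v = - Q x y v u" for x y u v
    by (simp add: Q_def commuting[of u v] br_act[of u v] br_act[of v u] act_minus)
  have "Q x y u v = Q x v u y" by (rule exchange)
  also have "\<dots> = - Q x v y u" by (rule skew)
  also have "\<dots> = - Q x u y v" by (simp only: exchange[of x v y u])
  also have "\<dots> = Q x u v y" by (simp only: skew[of x u y v] minus_minus)
  also have "\<dots> = Q x y v u" by (rule exchange)
  also have "\<dots> = - Q x y u v" by (rule skew)
  finally have "Q x y u v = - Q x y u v" .
  then have "Q x y u v + Q x y u v = 0"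
    by (metis add.right_inverse)
  then have "Q x y u v = 0"
    by (rule no_two_torsion)
  then show ?thesis
    by (simp add: Q_def eq_neg_iff_add_eq_0)
qed

lemma cyclic_sum_eq_0:
  "x \<cdot> g (br y z) + y \<cdot> g (br z x) + z \<cdot> g (br x y) = 0"
proof (rule faithful_br)
  fix u v
  have "br u v \<cdot> (x \<cdot> g (br y z) + y \<cdot> g (br z x) + z \<cdot> g (br x y))
      = - (br x (br y z) \<cdot> u \<cdot> g v + br y (br z x) \<cdot> u \<cdot> g v + br z (br x y) \<cdot> u \<cdot> g v)"
    by (simp only: act_add bracket_biderivation_swap[of u v]) (simp add: algebra_simps)
  also have "\<dots> = 0"
    by (simp add: br_act act_diff)
  finally show "br u v \<cdot> (x \<cdot> g (br y z) + y \<cdot> g (br z x) + z \<cdot> g (br x y)) = 0" .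
qed

theorem commuting_map_bracket: "g (br x y) = x \<cdot> g y"
proof -
  have annihilates: "z \<cdot> (g (br x y) - x \<cdot> g y) = 0" for z
  proof -
    let ?S = "x \<cdot> y \<cdot> g z + y \<cdot> z \<cdot> g x + z \<cdot> x \<cdot> g y"
    have bracket_out: "a \<cdot> g (br b c) = c \<cdot> b \<cdot> g a - b \<cdot> c \<cdot> g a" for a b c
      by (simp add: commuting[of a "br b c"] br_act)
    have flip: "y \<cdot> x \<cdot> g z = - (y \<cdot> z \<cdot> g x)" "z \<cdot> y \<cdot> g x = - (z \<cdot> x \<cdot> g y)"
        "x \<cdot> z \<cdot> g y = - (x \<cdot> y \<cdot> g z)"
      by (simp_all add: commuting[of x z] commuting[of y x] commuting[of z y] act_minus)
    \<comment> \<open>After flipping, each summand of \<open>?S\<close> occurs twice in the expanded cyclic sum.\<close>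
    have "x \<cdot> g (br y z) + y \<cdot> g (br z x) + z \<cdot> g (br x y) = - (?S + ?S)"
      unfolding bracket_out flip by (simp add: algebra_simps)
    then have "?S + ?S = 0"
      by (simp only: cyclic_sum_eq_0 neg_equal_0_iff_equal neg_0_equal_iff_equal)
    then have "?S = 0"
      by (rule no_two_torsion)
    moreover have "z \<cdot> (g (br x y) - x \<cdot> g y) = - ?S"
      unfolding act_diff bracket_out flip by (simp add: algebra_simps)
    ultimately show ?thesis by simp
  qed
  have "g (br x y) - x \<cdot> g y = 0"
    by (rule faithful_br) (rule annihilates)
  then show ?thesis by simp
qed

end

section \<open>Characteristic different from two\<close>

lemma (in vector_space) double_eq_0_imp_eq_0:
  fixes v :: 'b
  assumes "CHAR('a) \<noteq> 2" and "v + v = 0"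
  shows "v = 0"
proof -
  have "(2::'a) \<noteq> 0"
  proof
    assume "(2::'a) = 0"
    then have "CHAR('a) dvd 2"
      using of_nat_eq_0_iff_char_dvd[of 2, where 'a='a] by simp
    then show False
      using assms(1) CHAR_not_1'[where 'a='a] dvd_imp_le[of "CHAR('a)" 2]
      by (cases "CHAR('a)") auto
  qed
  moreover have "scale 2 v = 0"
    using assms(2) scale_left_distrib[of 1 1 v] by simp
  ultimately show ?thesis by simp
qed

section \<open>Centroid maps and commuting maps of a Hom-Lie module\<close>

context hom_lie_module
begin

lemma Cent_subset_Com:
  assumes "CHAR('f) \<noteq> 2"
  shows "Cent scaleL bracket \<alpha> scaleV \<rho> \<beta> \<subseteq> Com scaleL \<alpha> scaleV \<rho> \<beta>"
proof
  fix \<gamma> assume \<gamma>: "\<gamma> \<in> Cent scaleL bracket \<alpha> scaleV \<rho> \<beta>"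
  interpret \<gamma>: Vector_Spaces.linear scaleL scaleV \<gamma>
    using \<gamma> by (simp add: Cent_def)
  have "\<rho> (\<alpha> x) (\<gamma> x) = 0" for x
  proof -
    have "bracket x x + bracket x x = 0"
      using L.bracket_skew[of x x] by (metis add.right_inverse)
    then have "bracket x x = 0"
      using assms L.double_eq_0_imp_eq_0 by blast
    moreover have "\<rho> (\<alpha> x) (\<gamma> x) = \<gamma> (bracket x x)"
      using \<gamma> by (simp add: Cent_def)
    ultimately show ?thesis by (simp add: \<gamma>.zero)
  qed
  with \<gamma> show "\<gamma> \<in> Com scaleL \<alpha> scaleV \<rho> \<beta>"
    by (simp add: Cent_def Com_def)
qed

lemma annihilated_derived_algebraI:
  assumes "\<And>x y. \<rho> (bracket x y) v = 0"
  shows "v \<in> annihilated \<rho> (derived_algebra scaleL bracket)"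
proof -
  interpret orbit: Vector_Spaces.linear scaleL scaleV "\<lambda>s. \<rho> s v"
    by (rule linear_representation)
  have "\<rho> s v = 0" if "s \<in> L.span {bracket x y | x y. True}" for s
    by (rule orbit.eq_0_on_span[OF _ that]) (use assms in auto)
  then show ?thesis
    by (simp add: annihilated_def derived_algebra_def)
qed

lemma action_add: "\<rho> x (v + w) = \<rho> x v + \<rho> x w"
  using linear_action by (rule Vector_Spaces.linear.axioms(3)[THEN module_hom.add])

text \<open>Polarization of the condition \<open>\<alpha>(x) f(x) = 0\<close>.\<close>

lemma Com_skew:
  assumes "f \<in> Com scaleL \<alpha> scaleV \<rho> \<beta>"
  shows "\<rho> (\<alpha> x) (f y) = - \<rho> (\<alpha> y) (f x)"
proof -
  interpret f: Vector_Spaces.linear scaleL scaleV f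
    using assms by (simp add: Com_def)
  interpret \<alpha>: Vector_Spaces.linear scaleL scaleL \<alpha>
    by (rule L.linear_twist)
  have rep_add: "\<rho> (a + b) v = \<rho> a v + \<rho> b v" for a b v
    using linear_representation by (rule Vector_Spaces.linear.axioms(3)[THEN module_hom.add])
  have comm: "\<rho> (\<alpha> z) (f z) = 0" for z
    using assms by (simp add: Com_def)
  have "\<rho> (\<alpha> x) (f y) + \<rho> (\<alpha> y) (f x) = 0"
    using comm[of "x + y"] by (simp add: f.add \<alpha>.add action_add rep_add comm add.commute)
  then show ?thesis
    by (simp add: eq_neg_iff_add_eq_0)
qed

text \<open>
  The untwisting: \<open>inv \<beta> \<circ> \<rho> x\<close> is the action, \<open>inv \<alpha> (bracket x y)\<close> the bracket and
  \<open>inv \<beta> \<circ> f\<close> the commuting map. Everything rests on sliding \<open>\<beta>\<inverse>\<close> past an action, which replaces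
  \<open>x\<close> by \<open>\<alpha>(x)\<close>.
\<close>

lemma Com_subset_Cent:
  assumes char: "CHAR('f) \<noteq> 2" and surj: "surj \<alpha>" and bij: "bij \<beta>"
    and Z: "annihilated \<rho> (derived_algebra scaleL bracket) = {0}"
  shows "Com scaleL \<alpha> scaleV \<rho> \<beta> \<subseteq> Cent scaleL bracket \<alpha> scaleV \<rho> \<beta>"
proof
  fix f assume f: "f \<in> Com scaleL \<alpha> scaleV \<rho> \<beta>"
  interpret \<beta>: Vector_Spaces.linear scaleV scaleV \<beta>
    by (rule linear_module_twist)
  let ?B = "inv \<beta>" and ?A = "inv \<alpha>"
  have \<beta>_B [simp]: "\<beta> (?B v) = v" for v
    using bij by (simp add: bij_is_surj surj_f_inv_f)
  have B_\<beta> [simp]: "?B (\<beta> v) = v" for v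
    using bij by (simp add: bij_is_inj)
  have \<alpha>_A [simp]: "\<alpha> (?A x) = x" for x
    using surj by (simp add: surj_f_inv_f)
  have B_eq: "?B v = w \<longleftrightarrow> v = \<beta> w" for v w
    by auto
  have B_add: "?B (v + w) = ?B v + ?B w" for v w
    by (simp add: B_eq \<beta>.add)
  have B_diff: "?B (v - w) = ?B v - ?B w" for v w
    by (simp add: B_eq \<beta>.diff)
  have B_minus: "?B (- v) = - ?B v" for v
    by (simp add: B_eq \<beta>.neg)
  have \<beta>_act: "\<beta> (\<rho> x v) = \<rho> (\<alpha> x) (\<beta> v)" for x v
    using fun_cong[OF twist_action, of x v] by simp
  have slide: "\<rho> x (?B v) = ?B (\<rho> (\<alpha> x) v)" for x v
    by (metis B_eq \<beta>_B \<beta>_act)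
  have A_act: "\<rho> (?A x) v = ?B (\<rho> x (\<beta> v))" for x v
    by (metis B_eq \<alpha>_A \<beta>_act)
  have \<beta>_f: "\<beta> (f x) = f (\<alpha> x)" for x
    using f by (auto simp: Com_def fun_eq_iff)
  have f_A: "f (?A x) = ?B (f x)" for x
    by (metis B_eq \<alpha>_A \<beta>_f)
  interpret commuting_map "\<lambda>x v. ?B (\<rho> x v)" "\<lambda>x y. ?A (bracket x y)" "\<lambda>x. ?B (f x)"
  proof
    fix x y v w
    show "?B (\<rho> x (v + w)) = ?B (\<rho> x v) + ?B (\<rho> x w)"
      by (simp add: action_add B_add)
    show "?B (\<rho> (?A (bracket x y)) v)
        = ?B (\<rho> x (?B (\<rho> y v))) - ?B (\<rho> y (?B (\<rho> x v)))"
      by (simp add: A_act bracket_action slide B_diff)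
    show "?B (\<rho> x (?B (f y))) = - ?B (\<rho> y (?B (f x)))"
      by (simp add: slide Com_skew[OF f, of x y] B_minus)
  next
    fix v assume "\<And>x y. ?B (\<rho> (?A (bracket x y)) v) = 0"
    then have "\<rho> (bracket x y) (\<beta> v) = 0" for x y
      by (simp add: A_act B_eq \<beta>.zero)
    then have "\<beta> v = 0"
      using annihilated_derived_algebraI Z by blast
    then show "v = 0"
      by (metis B_\<beta> \<beta>.zero)
  next
    fix v :: 'v assume "v + v = 0"
    with char show "v = 0"
      by (rule V.double_eq_0_imp_eq_0)
  qed
  have "f (bracket x y) = \<rho> (\<alpha> x) (f y)" for x y
    using commuting_map_bracket[of x y] by (simp add: f_A slide B_eq)
  with f show "f \<in> Cent scaleL bracket \<alpha> scaleV \<rho> \<beta>"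
    by (simp add: Cent_def Com_def)
qed

end

theorem theorem4p3:
  fixes scaleL :: "'f::field \<Rightarrow> 'l::ab_group_add \<Rightarrow> 'l"
    and bracket :: "'l \<Rightarrow> 'l \<Rightarrow> 'l"
    and \<alpha> :: "'l \<Rightarrow> 'l"
    and scaleV :: "'f \<Rightarrow> 'v::ab_group_add \<Rightarrow> 'v"
    and \<rho> :: "'l \<Rightarrow> 'v \<Rightarrow> 'v"
    and \<beta> :: "'v \<Rightarrow> 'v"
  assumes "CHAR('f) \<noteq> 2"
    and "hom_lie_algebra scaleL bracket \<alpha>"
    and "surj \<alpha>"
    and "hom_lie_module scaleL bracket \<alpha> scaleV \<rho> \<beta>"
    and "bij \<beta>"
    and "annihilated \<rho> (derived_algebra scaleL bracket) = {0}"
  shows "Cent scaleL bracket \<alpha> scaleV \<rho> \<beta> = Com scaleL \<alpha> scaleV \<rho> \<beta>"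
proof -
  interpret hom_lie_module scaleL bracket \<alpha> scaleV \<rho> \<beta>
    by (fact assms(4))
  show ?thesis
    using Cent_subset_Com Com_subset_Cent assms by (intro equalityI) auto
qed

end
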